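(* Let $f\in\mathcal{U}$ and let $k(z)=z/(1-z)^2$. Then $$\frac{1}{2\pi}\int_0^{2\pi}|f^{(n)}(re^{i\theta})|^p\,d\theta\le\frac{1}{2\pi}\int_0^{2\pi}|k^{(n)}(re^{i\theta})|^p\,d\theta$$ whenever $0<r<1$, $p\ge1$ and $n=0,1,2,\ldots$. Moreover, for $n=0$ this inequality holds for every real number $p$ (and every $0<r<1$).
   Context: $\mathbb{D}=\{z\in\mathbb{C}:|z|<1\}$. $\mathcal{A}$ is the set of analytic functions on $\mathbb{D}$ of the form $f(z)=z+\sum_{n=2}^\infty a_nz^n$. $\mathcal{U}$ is the class of $f\in\mathcal{A}$ satisfying $\left|f'(z)\left(\frac{z}{f(z)}\right)^2-1\right|<1$ for all $z\in\mathbb{D}$ (where $z/f(z)$ has the value $1$ at $z=0$; such $f$ is nonvanishing in $\mathbb{D}\setminus\{0\}$). $f^{(n)}$ denotes the $n$-th derivative, with $f^{(0)}=f$. *)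

theory Defs
  imports "HOL-Complex_Analysis.Complex_Analysis"
begin

definition class_A :: "(complex \<Rightarrow> complex) set" where
  "class_A = {f. f holomorphic_on ball 0 1 \<and>
     (\<exists>a. \<forall>z\<in>ball 0 1. (\<lambda>n. a (n + 2) * z ^ (n + 2)) sums (f z - z))}"

(* HOL's 0 / 0 = 0 would give z / f z the value 0 at the origin; the value 1 is its
   continuous extension. Nonvanishing is what makes the quotient meaningful elsewhere. *)
definition z_over :: "(complex \<Rightarrow> complex) \<Rightarrow> complex \<Rightarrow> complex" where
  "z_over f z = (if z = 0 then 1 else z / f z)"

definition class_U :: "(complex \<Rightarrow> complex) set" where
  "class_U = {f \<in> class_A. (\<forall>z\<in>ball 0 1 - {0}. f z \<noteq> 0) \<and>
     (\<forall>z\<in>ball 0 1. norm (deriv f z * (z_over f z)\<^sup>2 - 1) < 1)}"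

definition koebe :: "complex \<Rightarrow> complex" where
  "koebe z = z / (1 - z)\<^sup>2"

(* HOL has 0 powr p = 0 for every p. This is the usual value for p > 0; for other p the
   mean is only meaningful if g has no zeros on the circle of radius r. *)
definition circle_mean :: "real \<Rightarrow> real \<Rightarrow> (complex \<Rightarrow> complex) \<Rightarrow> real" where
  "circle_mean p r g =
     1 / (2 * pi) * integral {0..2 * pi}
       (\<lambda>\<theta>. norm (g (of_real r * exp (\<i> * of_real \<theta>))) powr p)"

end

theory Submission
  imports Defs
begin

text \<open>Let \<open>k\<close> be the Koebe function. Everything rests on the statement that, for \<open>f\<close> in the class, \<open>f(z)/z\<close> is
subordinate to \<open>k(z)/z = 1/(1 - z)\<^sup>2\<close>; equivalently, \<open>f(z)/z = F(z)\<^sup>2\<close> with \<open>F(0) = 1\<close> and \<open>Re F > 1/2\<close>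
(\<open>class_U_sqrt_quotient\<close>). This follows from Jack's lemma: at a point where \<open>F\<close> first meets the line
\<open>Re = 1/2\<close>, the value of \<open>z F'\<close> is known up to a factor \<open>m \<ge> 1\<close>, and it contradicts the defining inequality
of the class.

For \<open>n = 0\<close> and any real \<open>p\<close>, put \<open>F = 1/(1 - w)\<close>; by the Schwarz lemma \<open>|w(z)| \<le> |z|\<close>. Since \<open>1 - z\<close> has no
zero in the disk, \<open>|1 - z|\<^sup>-\<^sup>2\<^sup>p\<close> is the squared modulus of a holomorphic function, and Littlewood's
subordination principle is needed in mean square only, where it is an orthogonality argument on Taylor
polynomials (\<open>L2_subordination\<close>).

For derivatives and \<open>p \<ge> 1\<close> it is enough that \<open>f\<close> is an average of the rotated Koebe functions \<open>k(x z)/x\<close>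
with \<open>|x| = 1\<close>: each of these has an \<open>n\<close>-th derivative with the same integral means as that of \<open>k\<close>, and means of
order \<open>p \<ge> 1\<close> are convex. As \<open>k(x z)/x = z (z/(1 - x z))'\<close>, such a representation amounts to a Herglotz
formula for the function \<open>H\<close> with \<open>z (z H)' = f\<close>, that is, to \<open>Re H > 1/2\<close>. This is a second application of
Jack's lemma (\<open>averaged_quotient_half_plane\<close>). To have a continuous density in the Herglotz formula, one
works on a circle of radius \<open>\<rho> < 1\<close> (\<open>class_U_koebe_representation\<close>), which costs a dilation by \<open>1/\<rho>\<close> that
disappears as \<open>\<rho>\<close> tends to 1.\<close>

section \<open>A half-plane form of Jack's lemma\<close>

text \<open>The point is a point of smallest modulus in the set where \<open>u \<ge> 0\<close>; equality holds there by continuity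
along the radius.\<close>
lemma first_contact_point:
  fixes u :: "complex \<Rightarrow> real"
  assumes u: "continuous_on (ball 0 1) u" and u0: "u 0 < 0"
    and ex: "z1 \<in> ball 0 1" "u z1 \<ge> 0"
  obtains z0 where "z0 \<in> ball 0 1" "z0 \<noteq> 0" "u z0 = 0" "\<And>z. norm z < norm z0 \<Longrightarrow> u z < 0"
proof -
  define S where "S = cball 0 (norm z1) \<inter> u -` {0..}"
  have sub: "cball 0 (norm z1) \<subseteq> ball (0::complex) 1" using ex(1) by auto
  have "closed S" unfolding S_def
    by (intro continuous_closed_preimage continuous_on_subset[OF u sub]) auto
  then have cS: "compact S"
    unfolding S_def by (metis S_def bounded_Int bounded_cball compact_eq_bounded_closed)
  have neS: "S \<noteq> {}" using ex by (auto simp: S_def)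
  obtain z0 where z0: "z0 \<in> S" and min: "\<And>z. z \<in> S \<Longrightarrow> norm z0 \<le> norm z"
    using continuous_attains_inf[OF cS neS, of norm] by (auto intro: continuous_intros)
  have below: "u z < 0" if "norm z < norm z0" for z
    using min[of z] that z0 by (force simp: S_def)
  have z0b: "z0 \<in> ball 0 1" using z0 sub by (auto simp: S_def)
  have z0n: "z0 \<noteq> 0" using z0 u0 by (auto simp: S_def)
  have "u (of_real 1 * z0) \<le> 0"
  proof (rule tendsto_upperbound)
    have "((\<lambda>t. of_real t * z0) \<longlongrightarrow> of_real 1 * z0) (at_left (1::real))"
      by (intro tendsto_intros)
    moreover have "isCont u (of_real 1 * z0)"
      using u z0b by (simp add: continuous_on_eq_continuous_at)
    ultimately show "((\<lambda>t. u (of_real t * z0)) \<longlongrightarrow> u (of_real 1 * z0)) (at_left 1)"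
      by (rule isCont_tendsto_compose[rotated])
    show "\<forall>\<^sub>F t in at_left 1. u (of_real t * z0) \<le> 0"
      using eventually_at_left_real[of 0 1]
      by (auto elim!: eventually_mono intro!: less_imp_le below simp: norm_mult z0n)
  qed simp_all
  moreover have "u z0 \<ge> 0" using z0 by (simp add: S_def)
  ultimately show ?thesis using that z0b z0n below by auto
qed

text \<open>The boundary part of Jack's lemma. Compare \<open>|v|\<^sup>2\<close> with \<open>|z|\<^sup>2\<close> along the ray \<open>1 - t \<alpha>\<close>, which enters
the disk at 1 whenever \<open>Re \<alpha> > 0\<close>: to first order this says \<open>Re ((d - 1) \<alpha>) \<ge> 0\<close>. With
\<open>\<alpha> = 1 + i s\<close> for every real \<open>s\<close> this forces \<open>d - 1\<close> to be real and nonnegative.\<close>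
lemma Jack_derivative:
  assumes der: "(v has_field_derivative d) (at 1)" and v1: "v 1 = 1"
    and le: "\<And>z. norm z < 1 \<Longrightarrow> norm (v z) \<le> norm (z::complex)"
  shows "Im d = 0" "Re d \<ge> 1"
proof -
  have key: "Re d - 1 \<ge> s * Im d" for s :: real
  proof (rule ccontr)
    assume neg: "\<not> ?thesis"
    define \<alpha> where "\<alpha> = Complex 1 s"
    define \<gamma> where "\<gamma> t = 1 - of_real t * \<alpha>" for t :: real
    define \<phi> where "\<phi> t = (norm (v (\<gamma> t)))\<^sup>2 - (norm (\<gamma> t))\<^sup>2" for t
    have g0: "\<gamma> 0 = 1" by (simp add: \<gamma>_def)
    have dg: "(\<gamma> has_vector_derivative - \<alpha>) (at 0)"
      unfolding \<gamma>_def by (auto intro!: derivative_eq_intros has_vector_derivative_real_field)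
    have dv: "((\<lambda>t. v (\<gamma> t)) has_vector_derivative (- \<alpha>) * d) (at 0)"
      using field_vector_diff_chain_at[OF dg, of v d] der by (simp add: g0 o_def)
    have n2: "(norm z)\<^sup>2 = z \<bullet> z" for z :: complex by (simp add: power2_norm_eq_inner)
    have "(\<phi> has_real_derivative 2 * Re ((- \<alpha>) * d) - 2 * Re (- \<alpha>)) (at 0)"
      unfolding \<phi>_def n2 has_real_derivative_iff_has_vector_derivative
      using has_vector_derivative_diff[OF
          bounded_bilinear.has_vector_derivative[OF bounded_bilinear_inner dv dv]
          bounded_bilinear.has_vector_derivative[OF bounded_bilinear_inner dg dg]]
      by (simp add: g0 v1 inner_complex_def)
    moreover have "2 * Re ((- \<alpha>) * d) - 2 * Re (- \<alpha>) > 0"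
      using neg by (simp add: \<alpha>_def)
    ultimately obtain \<delta> where \<delta>: "\<delta> > 0" "\<And>h. 0 < h \<Longrightarrow> h < \<delta> \<Longrightarrow> \<phi> 0 < \<phi> (0 + h)"
      using DERIV_pos_inc_right by blast
    \<comment> \<open>The second bound on the step keeps the point of the ray inside the disk.\<close>
    define h where "h = min (\<delta>/2) (1 / (1 + s\<^sup>2))"
    have s2: "1 + s\<^sup>2 > 0" by (simp add: add_pos_nonneg)
    have h: "0 < h" "h < \<delta>" "h * (1 + s\<^sup>2) \<le> 1"
      using \<delta>(1) s2 by (auto simp: h_def min_def field_simps)
    have "(norm (\<gamma> h))\<^sup>2 = (1 - h)\<^sup>2 + (h * s)\<^sup>2"
      by (simp add: \<gamma>_def \<alpha>_def cmod_power2)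
    also have "\<dots> = 1 - 2 * h + h * (h * (1 + s\<^sup>2))" by (simp add: power2_eq_square algebra_simps)
    also have "\<dots> \<le> 1 - 2 * h + h * 1" using h by (intro add_left_mono mult_left_mono) auto
    also have "\<dots> < 1" using h by simp
    finally have "norm (\<gamma> h) < 1" by (simp add: power_less_one_iff abs_square_less_1)
    then have "\<phi> h \<le> 0" unfolding \<phi>_def using le[of "\<gamma> h"] by (simp add: power_mono)
    moreover have "\<phi> 0 = 0" by (simp add: \<phi>_def g0 v1)
    ultimately show False using \<delta>(2)[OF h(1,2)] by simp
  qed
  show "Im d = 0"
  proof (rule ccontr)
    assume "Im d \<noteq> 0"
    \<comment> \<open>This value of the slope turns the inequality into \<open>Re d - 1 \<ge> Re d\<close>.\<close>
    then show False using key[of "(Re d) / Im d"] by simp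
  qed
  then show "Re d \<ge> 1" using key[of 0] by simp
qed

text \<open>Jack's lemma for functions that first leave the half-plane \<open>Re > 1/2\<close> at \<open>z0\<close>. The map
\<open>a \<mapsto> 1 - 1/a\<close> takes that half-plane to the unit disk, so after rescaling, \<open>1 - 1/H\<close> satisfies the
Schwarz lemma on the disk of radius \<open>|z0|\<close> and has modulus 1 at \<open>z0\<close>. The conclusion is
\<open>z0 \<omega>'(z0) = m \<omega>(z0)\<close> for \<open>\<omega> = 1 - 1/H\<close>, rewritten in terms of \<open>H\<close>.\<close>
lemma half_plane_Jack:
  assumes H: "H holomorphic_on ball 0 1" and H0: "H 0 = 1"
    and ex: "z1 \<in> ball 0 1" "Re (H z1) \<le> 1/2"
  obtains z0 m where "z0 \<in> ball 0 1" "z0 \<noteq> 0" "Re (H z0) = 1/2" "1 \<le> m"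
    "z0 * deriv H z0 = of_real m * (H z0 * (H z0 - 1))"
proof -
  have contH: "continuous_on (ball 0 1) H" using H by (rule holomorphic_on_imp_continuous_on)
  obtain z0 where z0: "z0 \<in> ball 0 1" "z0 \<noteq> 0" "1/2 - Re (H z0) = 0"
      "\<And>z. norm z < norm z0 \<Longrightarrow> 1/2 - Re (H z) < 0"
  proof (rule first_contact_point)
    show "continuous_on (ball 0 1) (\<lambda>z. 1/2 - Re (H z))" by (intro continuous_intros contH)
    show "1/2 - Re (H 0) < 0" "z1 \<in> ball 0 1" "0 \<le> 1/2 - Re (H z1)" using ex H0 by simp_all
  qed blast
  define a where "a = H z0"
  have re: "Re a = 1/2" using z0 by (simp add: a_def)
  have a0: "a \<noteq> 0" "a \<noteq> 1" using re by auto
  define b where "b = 1 - 1 / a"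
  have "1 - a = cnj a" using re by (simp add: complex_eq_iff)
  then have "norm (a - 1) = norm a" by (metis complex_mod_cnj norm_minus_commute)
  then have nb: "norm b = 1" using a0 by (simp add: b_def norm_divide field_simps)
  have b0: "b \<noteq> 0" using nb by auto
  define v where "v z = (1 - 1 / H (z0 * z)) / b" for z
  have in1: "z0 * z \<in> ball 0 1" "norm (z0 * z) < norm z0" if "norm z < 1" for z
    using that z0(1,2) by (auto simp: norm_mult intro: le_less_trans[OF mult_left_le, of _ _ 1])
  have nz: "H (z0 * z) \<noteq> 0" "Re (H (z0 * z)) > 1/2" if "norm z < 1" for z
    using z0(4)[OF in1(2)[OF that]] by auto
  have hol: "v holomorphic_on ball 0 1"
    unfolding v_def
    by (intro holomorphic_intros holomorphic_on_compose[of "\<lambda>z. z0 * z" _ H, unfolded o_def]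
         holomorphic_on_subset[OF H]) (use in1 nz b0 in auto)
  have lt1: "norm (v z) < 1" if "norm z < 1" for z
  proof -
    let ?h = "H (z0 * z)"
    have "(norm (?h - 1))\<^sup>2 < (norm ?h)\<^sup>2"
      using nz[OF that] unfolding cmod_power2 by (simp add: power2_eq_square algebra_simps)
    then have "norm (?h - 1) < norm ?h" by (rule power2_less_imp_less) simp
    moreover have "1 - 1 / ?h = (?h - 1) / ?h" using nz[OF that] by (simp add: field_simps)
    ultimately show ?thesis using nz[OF that] nb by (simp add: v_def norm_divide norm_mult)
  qed
  have le: "norm (v z) \<le> norm z" if "norm z < 1" for z
    using Schwarz_Lemma(1)[OF hol _ lt1 that] H0 by (simp add: v_def)
  have dH: "(H has_field_derivative deriv H z0) (at (z0 * 1))"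
    using H z0(1) by (simp add: holomorphic_derivI)
  have dHz: "((\<lambda>z. H (z0 * z)) has_field_derivative deriv H z0 * z0) (at 1)"
    by (rule DERIV_chain2[of H _ "\<lambda>z. z0 * z", OF dH]) (auto intro!: derivative_eq_intros)
  have "(v has_field_derivative (deriv H z0 * z0 / a\<^sup>2) / b) (at 1)"
    unfolding v_def
    using a0 by (auto intro!: derivative_eq_intros dHz simp: a_def b0 power2_eq_square)
  moreover have "v 1 = 1" by (simp add: v_def b_def[unfolded a_def, symmetric] b0)
  ultimately have d: "Im (deriv H z0 * z0 / a\<^sup>2 / b) = 0" "Re (deriv H z0 * z0 / a\<^sup>2 / b) \<ge> 1"
    using Jack_derivative[OF _ _ le] by auto
  define m where "m = Re (deriv H z0 * z0 / a\<^sup>2 / b)"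
  have "deriv H z0 * z0 / a\<^sup>2 / b = of_real m" using d by (simp add: m_def complex_eq_iff)
  then have "z0 * deriv H z0 = of_real m * (a\<^sup>2 * b)" using a0 b0 by (simp add: field_simps)
  moreover have "a\<^sup>2 * b = a * (a - 1)" using a0 by (simp add: b_def power2_eq_square field_simps)
  ultimately show ?thesis using that[of z0 m] z0 d re by (simp add: m_def a_def)
qed


section \<open>Circle integrals of holomorphic functions\<close>

text \<open>Cauchy's integral formula in the parametrization by the angle, with the kernel \<open>\<zeta>/(\<zeta> - z)\<close> written as
\<open>1/(1 - z/\<zeta>)\<close>.\<close>
lemma Cauchy_formula_circle_mean:
  fixes f :: "complex \<Rightarrow> complex"
  assumes "f holomorphic_on cball 0 \<rho>" "norm z < \<rho>"
  shows "((\<lambda>t. f (of_real \<rho> * cis t) / (1 - z / (of_real \<rho> * cis t))) has_integral 2 * pi * f z) {0..2*pi}"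
proof -
  have \<rho>: "\<rho> > 0" using norm_ge_zero[of z] assms(2) by linarith
  have "((\<lambda>u. f u / (u - z)) has_contour_integral 2 * complex_of_real pi * \<i> * f z) (circlepath 0 \<rho>)"
    using Cauchy_integral_circlepath_simple[OF assms(1)] assms(2) by simp
  then have "((\<lambda>t. f (of_real \<rho> * cis t) / (of_real \<rho> * cis t - z) * of_real \<rho> * \<i> * cis t) has_integral
      2 * complex_of_real pi * \<i> * f z) {0..2*pi}"
    unfolding circlepath_def by (subst (asm) has_contour_integral_part_circlepath_iff) auto
  from has_integral_mult_right[OF this, of "1/\<i>"] 
  have "((\<lambda>t. 1/\<i> * (f (of_real \<rho> * cis t) / (of_real \<rho> * cis t - z) * of_real \<rho> * \<i> * cis t)) has_integral
      2 * pi * f z) {0..2*pi}" by (simp add: algebra_simps)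
  moreover have "1/\<i> * (f (of_real \<rho> * cis t) / (of_real \<rho> * cis t - z) * of_real \<rho> * \<i> * cis t)
     = f (of_real \<rho> * cis t) / (1 - z / (of_real \<rho> * cis t))" for t
  proof -
    have "norm (of_real \<rho> * cis t) \<noteq> norm z" using assms \<rho> by (simp add: norm_mult)
    then have "of_real \<rho> * cis t - z \<noteq> 0" by auto
    moreover have "1/\<i> * (\<i> * c) = c" for c by simp
    ultimately show ?thesis using \<rho> by (simp add: divide_simps) (simp add: algebra_simps)
  qed
  ultimately show ?thesis by simp
qed

text \<open>The density is \<open>H + cnj H - 1\<close>. Against the kernel \<open>1/(1 - z/\<zeta>)\<close>, the summand \<open>H\<close> gives \<open>H z\<close> by Cauchy's
formula. The conjugate of the integral of \<open>cnj H\<close> is the mean of \<open>H(\<zeta>)/(1 - cnj z \<zeta>/\<rho>\<^sup>2)\<close>, which is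
holomorphic on the disk and has the value \<open>H 0 = 1\<close> at the origin; this cancels the summand 1.\<close>
lemma Herglotz_formula_circle:
  fixes H :: "complex \<Rightarrow> complex"
  assumes H: "H holomorphic_on ball 0 1" and H0: "H 0 = 1" and \<rho>: "\<rho> < 1" and z: "norm z < \<rho>"
  shows "((\<lambda>t. of_real (2 * Re (H (of_real \<rho> * cis t)) - 1) / (1 - z / (of_real \<rho> * cis t)))
     has_integral 2 * pi * H z) {0..2*pi}"
proof -
  have \<rho>0: "\<rho> > 0" using norm_ge_zero[of z] z by linarith
  have Hc: "H holomorphic_on cball 0 \<rho>" using H \<rho> by (auto intro: holomorphic_on_subset)
  have cz: "norm (cnj z / (of_real \<rho>)\<^sup>2 * u) < 1" if "norm u \<le> \<rho>" for u
  proof -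
    have "norm z * norm u \<le> norm z * \<rho>" using that by (intro mult_left_mono) auto
    also have "\<dots> < \<rho> * \<rho>" using z \<rho>0 by simp
    finally show ?thesis using \<rho>0 by (simp add: norm_mult norm_divide norm_power field_simps power2_eq_square)
  qed
  have ne: "1 - cnj z / (of_real \<rho>)\<^sup>2 * u \<noteq> 0" if "norm u \<le> \<rho>" for u using cz[OF that] by auto
  have "(\<lambda>u. H u / (1 - cnj z / (of_real \<rho>)\<^sup>2 * u)) holomorphic_on cball 0 \<rho>"
    by (intro holomorphic_intros Hc) (use ne in auto)
  from Cauchy_formula_circle_mean[OF this, of 0] \<rho>0 
  have "((\<lambda>t. H (of_real \<rho> * cis t) / (1 - cnj z / (of_real \<rho>)\<^sup>2 * (of_real \<rho> * cis t))) has_integral 2 * pi) {0..2*pi}"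
    by (simp add: H0)
  from has_integral_linear[OF this bounded_linear_cnj]
  have "((\<lambda>t. cnj (H (of_real \<rho> * cis t)) / (1 - z / (of_real \<rho>)\<^sup>2 * (of_real \<rho> * cnj (cis t)))) has_integral 2 * pi) {0..2*pi}"
    by (simp add: o_def)
  moreover have "z / (of_real \<rho>)\<^sup>2 * (of_real \<rho> * cnj (cis t)) = z / (of_real \<rho> * cis t)" for t
  proof -
    have "cnj (cis t) = 1 / cis t" by (simp add: cis_cnj divide_inverse)
    then show ?thesis using \<rho>0 by (simp add: power2_eq_square)
  qed
  ultimately have 1: "((\<lambda>t. cnj (H (of_real \<rho> * cis t)) / (1 - z / (of_real \<rho> * cis t))) has_integral 2 * pi) {0..2*pi}"
    by simp
  have 2: "((\<lambda>t. 1 / (1 - z / (of_real \<rho> * cis t))) has_integral 2 * pi) {0..2*pi}"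
    using Cauchy_formula_circle_mean[of "\<lambda>_. 1" \<rho> z] z by simp
  have eq: "complex_of_real (2 * Re w - 1) = w + cnj w - 1" for w by (simp add: complex_eq_iff)
  show ?thesis
    unfolding eq add_divide_distrib diff_divide_distrib
    using has_integral_diff[OF has_integral_add[OF Cauchy_formula_circle_mean[OF Hc z] 1] 2]
    by (simp add: algebra_simps)
qed


text \<open>The variable ranges over the disk of radius \<open>\<rho>\<close> while the multipliers \<open>x t\<close> may have modulus up to
\<open>1/\<rho>\<close>: in the Herglotz formula the weights sit on the circle of radius \<open>\<rho>\<close>, so that the multipliers
lie outside the unit disk.\<close>
lemma deriv_weighted_dilations:
  assumes K: "K holomorphic_on ball 0 1" and c: "continuous_on {a..b::real} c" and x: "continuous_on {a..b} x"
    and nx: "\<And>t. t \<in> {a..b} \<Longrightarrow> norm (x t) \<le> 1 / \<rho>" and z: "norm z < \<rho>"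
  shows "((\<lambda>z. integral {a..b} (\<lambda>t. c t * K (x t * z))) has_field_derivative
      integral {a..b} (\<lambda>t. c t * x t * deriv K (x t * z))) (at z)"
proof -
  have \<rho>0: "\<rho> > 0" using norm_ge_zero[of z] z by linarith
  have in1: "x t * y \<in> ball 0 1" if "t \<in> {a..b}" "norm y < \<rho>" for t and y :: complex
  proof -
    have "norm (x t) * norm y \<le> 1 / \<rho> * norm y" using nx[OF that(1)] by (intro mult_right_mono) auto
    also have "\<dots> < 1" using that(2) \<rho>0 by (simp add: field_simps)
    finally show ?thesis by (simp add: norm_mult)
  qed
  have cK: "continuous_on (ball 0 1) K" "continuous_on (ball 0 1) (deriv K)"
    using K by (auto intro!: holomorphic_on_imp_continuous_on holomorphic_deriv)
  have "((\<lambda>z. integral (cbox a b) (\<lambda>t. c t * K (x t * z))) has_field_derivative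
      integral (cbox a b) (\<lambda>t. c t * x t * deriv K (x t * z))) (at z within ball 0 \<rho>)"
  proof (rule leibniz_rule_field_derivative)
    fix y :: complex and t assume y: "y \<in> ball 0 \<rho>" and t: "t \<in> cbox a b"
    have "x t * y \<in> ball 0 1" using in1[of t y] y t by simp
    then have "(K has_field_derivative deriv K (x t * y)) (at (x t * y))"
      by (rule holomorphic_derivI[OF K open_ball])
    from DERIV_chain2[of K _ "\<lambda>y. x t * y", OF this DERIV_cmult_Id]
    have "((\<lambda>y. K (x t * y)) has_field_derivative deriv K (x t * y) * x t) (at y)" .
    then have "((\<lambda>y. c t * K (x t * y)) has_field_derivative c t * (deriv K (x t * y) * x t)) (at y)"
      by (rule DERIV_cmult)
    moreover have "c t * (deriv K (x t * y) * x t) = c t * x t * deriv K (x t * y)" by simp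
    ultimately show "((\<lambda>y. c t * K (x t * y)) has_field_derivative c t * x t * deriv K (x t * y)) (at y within ball 0 \<rho>)"
      by (metis has_field_derivative_at_within)
  next
    fix y :: complex assume "y \<in> ball 0 \<rho>"
    then show "(\<lambda>t. c t * K (x t * y)) integrable_on cbox a b"
      unfolding cbox_interval
      by (intro integrable_continuous_interval continuous_intros c x continuous_on_compose2[OF cK(1)])
         (use in1 in auto)
  next
    have [continuous_intros]: "continuous_on (ball 0 \<rho> \<times> {a..b}) (\<lambda>p. c (snd p))"
       "continuous_on (ball 0 \<rho> \<times> {a..b}) (\<lambda>p. x (snd p))"
      by (rule continuous_on_compose2[OF c], auto intro: continuous_intros)
         (rule continuous_on_compose2[OF x], auto intro: continuous_intros)
    show "continuous_on (ball 0 \<rho> \<times> cbox a b) (\<lambda>(y, t). c t * x t * deriv K (x t * y))"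
      unfolding cbox_interval case_prod_beta
      by (intro continuous_intros continuous_on_compose2[OF cK(2)]) (use in1 in auto)
  qed (use z in auto)
  moreover have "at z within ball 0 \<rho> = at z" using z by (intro at_within_open) auto
  ultimately show ?thesis by (simp only: cbox_interval)
qed

lemma higher_deriv_weighted_dilations:
  assumes K: "K holomorphic_on ball 0 1" and c: "continuous_on {a..b::real} c" and x: "continuous_on {a..b} x"
    and nx: "\<And>t. t \<in> {a..b} \<Longrightarrow> norm (x t) \<le> 1 / \<rho>" 
    and f: "\<And>z. norm z < \<rho> \<Longrightarrow> f z = integral {a..b} (\<lambda>t. c t * K (x t * z))" and z: "norm z < \<rho>"
  shows "(deriv ^^ n) f z = integral {a..b} (\<lambda>t. c t * x t ^ n * (deriv ^^ n) K (x t * z))"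
  using z
proof (induction n arbitrary: z)
  case 0
  then show ?case by (simp add: f)
next
  case (Suc n)
  have Kn: "(deriv ^^ n) K holomorphic_on ball 0 1" using K by (simp add: holomorphic_higher_deriv)
  have "((\<lambda>z. integral {a..b} (\<lambda>t. c t * x t ^ n * (deriv ^^ n) K (x t * z))) has_field_derivative
      integral {a..b} (\<lambda>t. c t * x t ^ n * x t * deriv ((deriv ^^ n) K) (x t * z))) (at z)"
  proof (rule deriv_weighted_dilations[OF Kn _ x nx Suc.prems])
    show "continuous_on {a..b} (\<lambda>t. c t * x t ^ n)" by (intro continuous_intros c x)
  qed
  then have "((deriv ^^ n) f has_field_derivative
      integral {a..b} (\<lambda>t. c t * x t ^ n * x t * deriv ((deriv ^^ n) K) (x t * z))) (at z)"
  proof (rule has_field_derivative_transform_within_open)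
    show "open (ball 0 \<rho>)" "z \<in> ball 0 \<rho>" using Suc.prems by simp_all
    fix y :: complex assume "y \<in> ball 0 \<rho>"
    then have "norm y < \<rho>" by simp
    then show "integral {a..b} (\<lambda>t. c t * x t ^ n * (deriv ^^ n) K (x t * y)) = (deriv ^^ n) f y"
      by (rule Suc.IH[symmetric])
  qed
  then have "deriv ((deriv ^^ n) f) z =
      integral {a..b} (\<lambda>t. c t * x t ^ n * x t * deriv ((deriv ^^ n) K) (x t * z))"
    by (rule DERIV_imp_deriv)
  then show ?case by (simp only: funpow.simps o_apply power_Suc2 mult.assoc)
qed


section \<open>Jensen's inequality and rotation invariance\<close>

text \<open>The graph of a convex power lies above its tangents.\<close>
lemma powr_tangent:
  fixes p a s :: real
  assumes "1 \<le> p" "0 \<le> s" "0 \<le> a"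
  shows "a powr p + p * a powr (p - 1) * (s - a) \<le> s powr p"
proof (cases "a = 0 \<or> s = 0")
  case True
  have "a powr p = a * a powr (p - 1)" if "a > 0"
    using that by (simp add: powr_mult_base)
  then have "s = 0 \<Longrightarrow> a > 0 \<Longrightarrow> a powr p + p * a powr (p - 1) * (s - a) = (1 - p) * a powr p"
    by (simp add: algebra_simps)
  moreover have "(1 - p) * a powr p \<le> 0" using assms by (simp add: mult_nonpos_nonneg)
  ultimately show ?thesis using True assms by fastforce
next
  case False
  then have a: "a > 0" "s > 0" using assms by auto
  have "((\<lambda>x. x powr p) has_real_derivative p * a powr (p - 1)) (at a within {0<..})"
    using a by (auto intro!: derivative_eq_intros)
  from convex_on_imp_above_tangent[OF powr_convex[OF assms(1)] _ _ _ this, of s]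
  show ?thesis using a by (simp add: interior_open algebra_simps)
qed

text \<open>Integrate the tangent inequality at the mean \<open>m\<close> against the weight \<open>q\<close>; the linear term vanishes.\<close>
lemma powr_Jensen_integral:
  fixes q g :: "real \<Rightarrow> real"
  assumes p: "1 \<le> p" and q: "continuous_on {a..b} q" and g: "continuous_on {a..b} g"
    and q0: "\<And>t. t \<in> {a..b} \<Longrightarrow> 0 \<le> q t" and g0: "\<And>t. t \<in> {a..b} \<Longrightarrow> 0 \<le> g t"
    and one: "integral {a..b} q = 1"
  shows "integral {a..b} (\<lambda>t. q t * g t) powr p \<le> integral {a..b} (\<lambda>t. q t * g t powr p)"
proof -
  define m where "m = integral {a..b} (\<lambda>t. q t * g t)"
  have m0: "m \<ge> 0" unfolding m_def by (intro integral_nonneg integrable_continuous_interval continuous_intros q g) (auto simp: q0 g0)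
  have i: "((\<lambda>t. q t) has_integral 1) {a..b}" "((\<lambda>t. q t * g t) has_integral m) {a..b}"
    unfolding m_def one[symmetric]
    by (intro integrable_integral integrable_continuous_interval continuous_intros q g)+
  have "((\<lambda>t. (m powr p - p * m powr (p-1) * m) * q t + p * m powr (p - 1) * (q t * g t)) has_integral
      (m powr p - p * m powr (p-1) * m) * 1 + p * m powr (p-1) * m) {a..b}"
    by (intro has_integral_add has_integral_mult_right i)
  moreover have "((\<lambda>t. q t * g t powr p) has_integral integral {a..b} (\<lambda>t. q t * g t powr p)) {a..b}"
    using p by (intro integrable_integral integrable_continuous_interval continuous_intros continuous_on_powr' q g)
       (auto simp: g0)
  moreover have "(m powr p - p * m powr (p-1) * m) * q t + p * m powr (p - 1) * (q t * g t) \<le> q t * g t powr p"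
    if "t \<in> {a..b}" for t
    using mult_left_mono[OF powr_tangent[OF p g0[OF that] m0] q0[OF that]] by (simp add: algebra_simps)
  ultimately have "(m powr p - p * m powr (p-1) * m) * 1 + p * m powr (p-1) * m \<le> integral {a..b} (\<lambda>t. q t * g t powr p)"
    by (rule has_integral_le)
  then show ?thesis by (simp add: m_def)
qed

lemma integral_circle_rotate:
  fixes g :: "complex \<Rightarrow> real"
  assumes g: "continuous_on (sphere 0 R) g" and R: "R \<ge> 0" and t: "t \<in> {0..2*pi}"
  shows "integral {0..2*pi} (\<lambda>\<theta>. g (of_real R * cis (\<theta> - t))) = integral {0..2*pi} (\<lambda>\<theta>. g (of_real R * cis \<theta>))"
proof -
  let ?G = "\<lambda>\<theta>. g (of_real R * cis \<theta>)"
  have c: "continuous_on A ?G" for A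
    by (intro continuous_on_compose2[OF g] continuous_intros) (use R in \<open>auto simp: norm_mult\<close>)
  have int: "?G integrable_on {a..b}" for a b by (intro integrable_continuous_interval c)
  have "integral {0..2*pi} (\<lambda>\<theta>. ?G (\<theta> - t)) = integral {-t..2*pi-t} ?G"
    using integral_shift_real_ivl[of "-t" "-t" "2*pi-t" ?G] by simp
  also have "\<dots> = integral {-t..0} ?G + integral {0..2*pi-t} ?G"
    using t by (intro Henstock_Kurzweil_Integration.integral_combine[symmetric] int) auto
  also have "integral {-t..0} ?G = integral {2*pi-t..2*pi} ?G"
  proof -
    have "cis (x + 2*pi) = cis x" for x by (metis cis_2pi cis_mult mult.right_neutral)
    then show ?thesis using integral_shift_real_ivl[of "2*pi-t" "2*pi" "2*pi" ?G] by simp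
  qed
  also have "integral {2*pi-t..2*pi} ?G + integral {0..2*pi-t} ?G = integral {0..2*pi} ?G"
    using t by (subst add.commute) (intro Henstock_Kurzweil_Integration.integral_combine int; simp)
  finally show ?thesis by simp
qed

section \<open>Littlewood subordination in mean square\<close>

text \<open>Constants are orthogonal to functions that vanish at the origin, by the mean value property.\<close>
lemma circle_mean_square_add_constant:
  assumes w: "w holomorphic_on ball 0 1" "w 0 = 0" and r: "0 < r" "r < 1"
  shows "integral {0..2*pi} (\<lambda>t. (norm (a + w (of_real r * cis t)))\<^sup>2) =
    2 * pi * (norm a)\<^sup>2 + integral {0..2*pi} (\<lambda>t. (norm (w (of_real r * cis t)))\<^sup>2)"
proof -
  have wc: "(\<lambda>z. cnj a * w z) holomorphic_on cball 0 r"
    using r by (intro holomorphic_intros holomorphic_on_subset[OF w(1)]) auto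
  from Cauchy_formula_circle_mean[OF wc, of 0] r w(2)
  have "((\<lambda>t. cnj a * w (of_real r * cis t)) has_integral 0) {0..2*pi}" by simp
  from has_integral_linear[OF this bounded_linear_Re]
  have 1: "((\<lambda>t. Re (cnj a * w (of_real r * cis t))) has_integral 0) {0..2*pi}" by (simp add: o_def)
  have c: "continuous_on {0..2*pi} (\<lambda>t. w (of_real r * cis t))"
    by (intro continuous_on_compose2[OF holomorphic_on_imp_continuous_on[OF w(1)]] continuous_intros)
       (use r in \<open>auto simp: norm_mult\<close>)
  have 2: "((\<lambda>t. (norm (w (of_real r * cis t)))\<^sup>2) has_integral
      integral {0..2*pi} (\<lambda>t. (norm (w (of_real r * cis t)))\<^sup>2)) {0..2*pi}"
    by (intro integrable_integral integrable_continuous_interval continuous_intros c)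
  have eq: "(norm (a + b))\<^sup>2 = (norm a)\<^sup>2 + 2 * Re (cnj a * b) + (norm b)\<^sup>2" for b
    unfolding cmod_power2 by (simp add: power2_eq_square algebra_simps)
  have "((\<lambda>t. (norm a)\<^sup>2) has_integral (2 * pi) * (norm a)\<^sup>2) {0..2*pi}"
    using has_integral_const_real[of "(norm a)\<^sup>2" 0 "2*pi"] by simp
  from has_integral_add[OF has_integral_add[OF this has_integral_mult_right[OF 1, of 2]] 2]
  show ?thesis unfolding eq by (simp add: integral_unique)
qed

text \<open>Write the polynomial as \<open>a + z Q\<close>. By orthogonality \<open>|a + w Q(w)|\<^sup>2\<close> has the integral of \<open>|a|\<^sup>2\<close> plus that of
\<open>|w Q(w)|\<^sup>2\<close>, and \<open>|w| \<le> r\<close> on the circle of radius \<open>r\<close>. For \<open>w(z) = z\<close> each of these steps is an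
equality, so the induction passes from \<open>Q\<close> to \<open>a + z Q\<close>.\<close>
lemma L2_subordination_poly:
  assumes w: "w holomorphic_on ball 0 1" "w 0 = 0" "\<And>z. norm z < 1 \<Longrightarrow> norm (w z) \<le> norm z"
    and r: "0 < r" "r < 1"
  shows "integral {0..2*pi} (\<lambda>t. (norm (poly P (w (of_real r * cis t))))\<^sup>2) \<le>
    integral {0..2*pi} (\<lambda>t. (norm (poly P (of_real r * cis t)))\<^sup>2)"
proof (induction P)
  case 0
  then show ?case by simp
next
  case (pCons a Q)
  have hp: "(\<lambda>z. poly Q (v z)) holomorphic_on ball 0 1" if "v holomorphic_on ball 0 1" for v :: "complex \<Rightarrow> complex"
    by (induction Q) (auto intro!: holomorphic_intros that)
  have wc: "continuous_on {0..2*pi} (\<lambda>t. v (of_real r * cis t))" if "v holomorphic_on ball 0 1" for v :: "complex \<Rightarrow> complex"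
    by (intro continuous_on_compose2[OF holomorphic_on_imp_continuous_on[OF that]] continuous_intros)
       (use r in \<open>auto simp: norm_mult\<close>)
  have nw: "norm (w (of_real r * cis t)) \<le> r" for t
    using w(3)[of "of_real r * cis t"] r by (simp add: norm_mult)
  have "integral {0..2*pi} (\<lambda>t. (norm (w (of_real r * cis t) * poly Q (w (of_real r * cis t))))\<^sup>2) \<le>
     integral {0..2*pi} (\<lambda>t. r\<^sup>2 * (norm (poly Q (w (of_real r * cis t))))\<^sup>2)"
  proof (intro integral_le integrable_continuous_interval continuous_intros wc w(1) hp)
    show "(norm (w (of_real r * cis t) * poly Q (w (of_real r * cis t))))\<^sup>2 \<le> r\<^sup>2 * (norm (poly Q (w (of_real r * cis t))))\<^sup>2" for t
      unfolding norm_mult power_mult_distrib using nw[of t] by (intro mult_right_mono power_mono) auto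
  qed
  also have "\<dots> \<le> r\<^sup>2 * integral {0..2*pi} (\<lambda>t. (norm (poly Q (of_real r * cis t)))\<^sup>2)"
    using pCons.IH by (simp add: mult_left_mono)
  also have "\<dots> = integral {0..2*pi} (\<lambda>t. (norm (of_real r * cis t * poly Q (of_real r * cis t)))\<^sup>2)"
    using r by (simp add: norm_mult power_mult_distrib)
  finally show ?case
    using circle_mean_square_add_constant[OF holomorphic_on_mult[OF w(1) hp[OF w(1)]] _ r, of a]
      circle_mean_square_add_constant[OF holomorphic_on_mult[OF holomorphic_on_ident hp[OF holomorphic_on_ident]] _ r, of a] w(2)
    by simp
qed

text \<open>The Taylor polynomials of \<open>h\<close> converge uniformly on the closed disk of radius \<open>r\<close>, which contains both
\<open>r e\<^sup>i\<^sup>t\<close> and its image under \<open>w\<close>.\<close>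
lemma L2_subordination:
  assumes h: "h holomorphic_on ball 0 1"
    and w: "w holomorphic_on ball 0 1" "w 0 = 0" "\<And>z. norm z < 1 \<Longrightarrow> norm (w z) \<le> norm z"
    and r: "0 < r" "r < 1"
  shows "integral {0..2*pi} (\<lambda>t. (norm (h (w (of_real r * cis t))))\<^sup>2) \<le>
    integral {0..2*pi} (\<lambda>t. (norm (h (of_real r * cis t)))\<^sup>2)"
proof -
  define c where "c n = (deriv ^^ n) h 0 / fact n" for n
  define P where "P N = (\<Sum>n<N. monom (c n) n)" for N
  have sums: "(\<lambda>n. c n * z ^ n) sums h z" if "norm z < 1" for z
    using holomorphic_power_series[OF h, of z] that by (simp add: c_def)
  obtain s where s: "r < s" "s < 1" using r(2) dense by blast
  have "ereal r < norm (of_real s :: complex)" using s r by simp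
  also have "\<dots> \<le> conv_radius c"
    using sums_summable[OF sums, of "of_real s"] s r by (intro conv_radius_geI) auto
  finally have rad: "ereal r < conv_radius c" .
  have uni: "uniform_limit (cball 0 r) (\<lambda>N z. poly (P N) z) h sequentially"
  proof -
    have "uniform_limit (cball 0 r) (\<lambda>N z. \<Sum>i<N. c i * (z - 0) ^ i) (\<lambda>z. \<Sum>i. c i * (z - 0) ^ i) sequentially"
      by (rule powser_uniform_limit[OF rad])
    moreover have "(\<Sum>i. c i * (z - 0) ^ i) = h z" if "z \<in> cball 0 r" for z
      using sums[of z] that r by (simp add: sums_iff)
    ultimately show ?thesis
      by (subst uniform_limit_cong'[where i = "\<lambda>z. \<Sum>i. c i * (z - 0) ^ i"])
         (auto simp: P_def poly_sum poly_monom)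
  qed
  have hc: "continuous_on (cball 0 r) h"
    using r by (intro holomorphic_on_imp_continuous_on holomorphic_on_subset[OF h]) auto
  have conv: "(\<lambda>N. integral {0..2*pi} (\<lambda>t. (norm (poly (P N) (v t)))\<^sup>2)) \<longlonglongrightarrow> integral {0..2*pi} (\<lambda>t. (norm (h (v t)))\<^sup>2)"
    if v: "continuous_on {0..2*pi} v" and vr: "\<And>t. norm (v t) \<le> r" for v :: "real \<Rightarrow> complex"
  proof -
    have "uniform_limit {0..2*pi} (\<lambda>N t. norm (poly (P N) (v t))) (\<lambda>t. norm (h (v t))) sequentially"
      by (intro uniform_limit_norm uniform_limit_compose'[OF uni]) (use vr in auto)
    moreover have b: "bounded ((\<lambda>t. norm (h (v t))) ` {0..2*pi})"
      by (intro compact_imp_bounded compact_continuous_image continuous_intros continuous_on_compose2[OF hc v])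
         (use vr in auto)
    ultimately have u: "uniform_limit {0..2*pi} (\<lambda>N t. (norm (poly (P N) (v t)))\<^sup>2) (\<lambda>t. (norm (h (v t)))\<^sup>2) sequentially"
      unfolding power2_eq_square by (intro uniform_lim_mult)
    have cP: "continuous_on {0..2*pi} (\<lambda>t. (norm (poly (P N) (v t)))\<^sup>2)" for N
      by (intro continuous_intros v)
    obtain I J where IJ: "\<And>N. ((\<lambda>t. (norm (poly (P N) (v t)))\<^sup>2) has_integral I N) {0..2*pi}"
       "((\<lambda>t. (norm (h (v t)))\<^sup>2) has_integral J) {0..2*pi}" "I \<longlonglongrightarrow> J"
      using uniform_limit_integral[OF u cP sequentially_bot] by blast
    from integral_unique[OF IJ(1)] integral_unique[OF IJ(2)] IJ(3) show ?thesis by simp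
  qed
  have nw: "norm (w (of_real r * cis t)) \<le> r" for t
    using w(3)[of "of_real r * cis t"] r by (simp add: norm_mult)
  have wc: "continuous_on {0..2*pi} (\<lambda>t. w (of_real r * cis t))"
    by (intro continuous_on_compose2[OF holomorphic_on_imp_continuous_on[OF w(1)]] continuous_intros)
       (use r in \<open>auto simp: norm_mult\<close>)
  show ?thesis
    by (rule LIMSEQ_le[OF conv[OF wc nw] conv])
       (use r in \<open>auto intro!: continuous_intros exI[of _ 0] L2_subordination_poly w simp: norm_mult\<close>)
qed

section \<open>Two half-plane conditions for the class U\<close>
lemma class_A_normalized:
  assumes "f \<in> class_A"
  shows "f 0 = 0" "(f has_field_derivative 1) (at 0)"
proof -
  obtain a where a: "\<And>z. z \<in> ball 0 1 \<Longrightarrow> (\<lambda>n. a (n + 2) * z ^ (n + 2)) sums (f z - z)"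
    using assms unfolding class_A_def by blast
  define c where "c n = (if n < 2 then 0 else a n)" for n :: nat
  have cs: "(\<lambda>n. c n * z ^ n) sums (f z - z)" if "norm z < 1" for z
  proof -
    have "(\<lambda>n. c (n + 2) * z ^ (n + 2)) sums (f z - z)" using a[of z] that by (simp add: c_def)
    then show ?thesis by (subst (asm) sums_iff_shift) (simp add: c_def lessThan_Suc eval_nat_numeral)
  qed
  from cs[of 0] have "(\<lambda>n. c n * 0 ^ n) sums f 0" by simp
  moreover have "(\<lambda>n. c n * 0 ^ n) sums c 0" by (rule powser_sums_zero)
  ultimately show "f 0 = 0" by (metis (no_types) sums_unique2 c_def zero_less_numeral)
  have "((\<lambda>z. \<Sum>n. c n * z ^ n) has_field_derivative (\<Sum>n. diffs c n * 0 ^ n)) (at 0)"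
    by (rule termdiffs_strong'[of 1]) (use cs sums_summable in auto)
  moreover have "(\<Sum>n. diffs c n * 0 ^ n) = 0" by (simp add: powser_zero diffs_def c_def)
  ultimately have "((\<lambda>z. \<Sum>n. c n * z ^ n) has_field_derivative 0) (at 0)" by simp
  then have "((\<lambda>z. f z - z) has_field_derivative 0) (at 0)"
    by (rule has_field_derivative_transform_within_open[of _ _ _ "ball 0 1"])
       (use cs sums_unique in \<open>auto simp: sums_iff\<close>)
  from DERIV_add[OF this DERIV_ident] show "(f has_field_derivative 1) (at 0)" by simp
qed

text \<open>In terms of \<open>\<omega> = 1 - 1/F\<close> this is the subordination of \<open>f(z)/z\<close> to \<open>1/(1 - z)\<^sup>2\<close>. Since \<open>f(z)/z\<close> does not
vanish, it has a holomorphic square root \<open>F\<close> with \<open>F(0) = 1\<close>. If \<open>F\<close> left the half-plane at \<open>z0\<close>, then with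
\<open>a = F(z0) = 1/2 + i y\<close> Jack's lemma would give
\<open>f'(z0) (z0/f(z0))\<^sup>2 - 1 = (1 + 2 m (a - 1) - a\<^sup>2)/a\<^sup>2\<close>, whose modulus is at least 1 when \<open>m \<ge> 1\<close>.\<close>
lemma class_U_sqrt_quotient:
  assumes f: "f \<in> class_U"
  obtains F where "F holomorphic_on ball 0 1" "F 0 = 1"
    "\<And>z. norm z < 1 \<Longrightarrow> f z = z * (F z)\<^sup>2" "\<And>z. norm z < 1 \<Longrightarrow> 1/2 < Re (F z)"
proof -
  have fA: "f \<in> class_A" and nz: "\<And>z. norm z < 1 \<Longrightarrow> z \<noteq> 0 \<Longrightarrow> f z \<noteq> 0"
    and U: "\<And>z. norm z < 1 \<Longrightarrow> norm (deriv f z * (z_over f z)\<^sup>2 - 1) < 1"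
    using f by (auto simp: class_U_def)
  have hol: "f holomorphic_on ball 0 1" using fA by (simp add: class_A_def)
  note f0 = class_A_normalized[OF fA]
  define G where "G z = (if z = 0 then 1 else f z / z)" for z
  have "G holomorphic_on ball 0 1"
    by (rule pole_theorem_open_0[OF hol open_ball, of 0])
       (use f0 in \<open>auto simp: G_def DERIV_imp_deriv\<close>)
  moreover have "G z \<noteq> 0" if "z \<in> ball 0 1" for z using nz that by (auto simp: G_def)
  ultimately obtain F0 where F0: "F0 holomorphic_on ball 0 1" "\<And>z. z \<in> ball 0 1 \<Longrightarrow> G z = (F0 z)\<^sup>2"
    using contractible_imp_holomorphic_sqrt[of G "ball 0 1"] convex_imp_contractible[OF convex_ball] by blast
  \<comment> \<open>The given square root has the value 1 or -1 at the origin; this normalizes it.\<close>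
  define F where "F z = F0 0 * F0 z" for z
  have F00: "F0 0 * F0 0 = 1" using F0(2)[of 0] by (simp add: G_def power2_eq_square)
  have F: "F holomorphic_on ball 0 1" "F 0 = 1" unfolding F_def by (auto intro!: holomorphic_intros F0(1) F00)
  have fF: "f z = z * (F z)\<^sup>2" if "norm z < 1" for z
  proof -
    have "(F z)\<^sup>2 = G z" using F0(2)[of z] that F00 by (simp add: F_def power_mult_distrib power2_eq_square)
    then show ?thesis by (simp add: G_def f0)
  qed
  have "1/2 < Re (F z)" if "norm z < 1" for z
  proof (rule ccontr)
    assume "\<not> ?thesis"
    then have z: "z \<in> ball 0 1" "Re (F z) \<le> 1/2" using that by auto
    obtain z0 m where z0: "z0 \<in> ball 0 1" "z0 \<noteq> 0" "Re (F z0) = 1/2" "1 \<le> m"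
      "z0 * deriv F z0 = of_real m * (F z0 * (F z0 - 1))"
      using half_plane_Jack[OF F z] by blast
    define a where "a = F z0"
    have a0: "a \<noteq> 0" using z0(3) by (auto simp: a_def)
    have "((\<lambda>z. z * (F z)\<^sup>2) has_field_derivative (a\<^sup>2 + z0 * (2 * a * deriv F z0))) (at z0)"
      using holomorphic_derivI[OF F(1) open_ball z0(1)]
      by (auto intro!: derivative_eq_intros simp: a_def)
    then have "(f has_field_derivative (a\<^sup>2 + z0 * (2 * a * deriv F z0))) (at z0)"
      by (rule has_field_derivative_transform_within_open[of _ _ _ "ball 0 1"]) (use z0(1) fF in auto)
    then have "deriv f z0 = a\<^sup>2 + 2 * a * (z0 * deriv F z0)" by (simp add: DERIV_imp_deriv)
    also have "\<dots> = a\<^sup>2 * (1 + 2 * of_real m * (a - 1))"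
      unfolding z0(5) a_def[symmetric] by (simp add: power2_eq_square algebra_simps)
    finally have d: "deriv f z0 = a\<^sup>2 * (1 + 2 * of_real m * (a - 1))" .
    have zo: "z_over f z0 = 1 / a\<^sup>2" using z0(1,2) fF[of z0] a0 by (simp add: z_over_def a_def)
    have "norm (deriv f z0 * (z_over f z0)\<^sup>2 - 1) = norm ((1 + 2 * of_real m * (a - 1) - a\<^sup>2) / a\<^sup>2)"
    proof -
      have "a\<^sup>2 * s * (1 / a\<^sup>2)\<^sup>2 - 1 = (s - a\<^sup>2) / a\<^sup>2" for s
        using a0 by (simp add: diff_divide_distrib power2_eq_square)
      then show ?thesis unfolding d zo by metis
    qed
    then have "norm (1 + 2 * of_real m * (a - 1) - a\<^sup>2) < norm (a\<^sup>2)"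
      using U[of z0] z0(1) a0 by (simp add: norm_divide)
    then have lt: "(norm (1 + 2 * of_real m * (a - 1) - a\<^sup>2))\<^sup>2 < (norm (a\<^sup>2))\<^sup>2"
      by (intro power_strict_mono) auto
    define y where "y = Im a"
    have ay: "a = Complex (1/2) y" using z0(3) by (simp add: complex_eq_iff y_def a_def)
    have "(norm (1 + 2 * of_real m * (a - 1) - a\<^sup>2))\<^sup>2 = (3/4 + y\<^sup>2 - m)\<^sup>2 + (y * (2 * m - 1))\<^sup>2"
      unfolding ay cmod_power2 by (simp add: power2_eq_square algebra_simps)
    \<comment> \<open>The second summand is nonnegative because \<open>m \<ge> 1\<close>.\<close>
    also have "\<dots> = (1/4 + y\<^sup>2)\<^sup>2 + (y\<^sup>2 + 1/4) * ((2 * m - 1) * (2 * m - 2))"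
      by (simp add: power2_eq_square algebra_simps)
    also have "\<dots> \<ge> (1/4 + y\<^sup>2)\<^sup>2" using z0(4) by simp
    also have "(1/4 + y\<^sup>2)\<^sup>2 = (norm (a\<^sup>2))\<^sup>2"
      unfolding ay norm_power cmod_power2 by (simp add: power2_eq_square)
    finally show False using lt by linarith
  qed
  with that F fF show ?thesis by blast
qed

text \<open>Here \<open>H(z) = (1/z) \<integral> F\<^sup>2\<close> over the segment from 0 to \<open>z\<close>, so that \<open>H + z H' = F\<^sup>2\<close>. If \<open>H\<close> left the
half-plane at \<open>z0\<close> with \<open>H(z0) = 1/2 + i y\<close>, Jack's lemma would place \<open>F(z0)\<^sup>2\<close> at
\<open>1/2 - m (1/4 + y\<^sup>2) + i y\<close>, on or to the left of the parabola \<open>X = 1/4 - Y\<^sup>2\<close>. That parabola is the image of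
the line \<open>Re = 1/2\<close> under squaring, and squares of points with \<open>Re > 1/2\<close> lie strictly to its right.\<close>
lemma averaged_quotient_half_plane:
  assumes F: "F holomorphic_on ball 0 1" "F 0 = 1" "\<And>z. norm z < 1 \<Longrightarrow> 1/2 < Re (F z)"
  obtains H where "H holomorphic_on ball 0 1" "H 0 = 1" "\<And>z. norm z < 1 \<Longrightarrow> 1/2 < Re (H z)"
    "\<And>z. norm z < 1 \<Longrightarrow> ((\<lambda>z. z * H z) has_field_derivative (F z)\<^sup>2) (at z)"
proof -
  have "(\<lambda>z. (F z)\<^sup>2) holomorphic_on ball 0 1" by (intro holomorphic_intros F(1))
  from holomorphic_convex_primitive'[OF convex_ball open_ball this]
  obtain P0 where P0: "\<And>z. z \<in> ball 0 1 \<Longrightarrow> (P0 has_field_derivative (F z)\<^sup>2) (at z within ball 0 1)" by blast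
  define P where "P z = P0 z - P0 0" for z
  have P: "(P has_field_derivative (F z)\<^sup>2) (at z)" if "norm z < 1" for z
  proof -
    have "(P0 has_field_derivative (F z)\<^sup>2) (at z)"
      using P0[of z] that at_within_open[of z "ball 0 1"] by simp
    from DERIV_diff[OF this DERIV_const, of "P0 0"] show ?thesis by (simp add: P_def[abs_def])
  qed
  have Ph: "P holomorphic_on ball 0 1" using P by (subst holomorphic_on_open, simp) (metis mem_ball_0)
  define H where "H z = (if z = 0 then 1 else P z / z)" for z
  have Hh: "H holomorphic_on ball 0 1"
    by (rule pole_theorem_open_0[OF Ph open_ball, of 0])
       (use DERIV_imp_deriv[OF P[of 0]] F(2) in \<open>auto simp: H_def P_def\<close>)
  have H0: "H 0 = 1" by (simp add: H_def)
  have zH: "(\<lambda>z. z * H z) = P" by (auto simp: H_def P_def)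
  have eq: "H z + z * deriv H z = (F z)\<^sup>2" if "norm z < 1" for z
  proof -
    have "((\<lambda>z. z * H z) has_field_derivative H z + z * deriv H z) (at z)"
      using holomorphic_derivI[OF Hh open_ball, of z] that
      by (auto intro!: derivative_eq_intros)
    with P[OF that] show ?thesis unfolding zH by (rule DERIV_unique[symmetric])
  qed
  have "1/2 < Re (H z)" if "norm z < 1" for z
  proof (rule ccontr)
    assume "\<not> ?thesis"
    then have z: "z \<in> ball 0 1" "Re (H z) \<le> 1/2" using that by auto
    obtain z0 m where z0: "z0 \<in> ball 0 1" "z0 \<noteq> 0" "Re (H z0) = 1/2" "1 \<le> m"
      "z0 * deriv H z0 = of_real m * (H z0 * (H z0 - 1))"
      using half_plane_Jack[OF Hh H0 z] by blast
    define y where "y = Im (H z0)"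
    define a where "a = Re (F z0)"
    define b where "b = Im (F z0)"
    have Hy: "H z0 = Complex (1/2) y" using z0(3) by (simp add: complex_eq_iff y_def)
    have a: "a > 1/2" using F(3)[of z0] z0(1) by (simp add: a_def)
    have sq: "(F z0)\<^sup>2 = H z0 + of_real m * (H z0 * (H z0 - 1))" using eq[of z0] z0 by simp
    have 1: "a\<^sup>2 - b\<^sup>2 = 1/2 - m * (1/4 + y\<^sup>2)"
      using arg_cong[OF sq, of Re] unfolding Hy a_def b_def by (simp add: power2_eq_square algebra_simps)
    have 2: "2 * a * b = y"
      using arg_cong[OF sq, of Im] unfolding Hy a_def b_def by (simp add: power2_eq_square algebra_simps)
    have "1 * (1/4 + y\<^sup>2) \<le> m * (1/4 + y\<^sup>2)" using z0(4) by (intro mult_right_mono) auto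
    with 1 have "a\<^sup>2 - b\<^sup>2 \<le> 1/4 - y\<^sup>2" by simp
    then have "(a\<^sup>2 - 1/4) * (1 + 4 * b\<^sup>2) \<le> 0"
      unfolding 2[symmetric] by (simp add: power2_eq_square algebra_simps)
    moreover have "a\<^sup>2 > (1/2)\<^sup>2" using a by (intro power_strict_mono) auto
    moreover have "1 + 4 * b\<^sup>2 > 0" by (simp add: add_pos_nonneg)
    ultimately show False by (simp add: mult_le_0_iff power2_eq_square)
  qed
  with that Hh H0 P zH show ?thesis by metis
qed

section \<open>Averages of dilated Koebe functions\<close>
lemma koebe_holomorphic: "koebe holomorphic_on ball 0 1"
  unfolding koebe_def[abs_def] by (auto intro!: holomorphic_intros)

text \<open>The Herglotz formula for \<open>H\<close> writes \<open>z H(z)\<close> as an average of \<open>z/(1 - x z)\<close> with \<open>|x| = 1/\<rho>\<close>.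
Differentiating turns the kernel into \<open>1/(1 - x z)\<^sup>2\<close> and the left-hand side into \<open>f(z)/z\<close>, and
\<open>z/(1 - x z)\<^sup>2\<close> is \<open>k(x z)/x\<close> for the Koebe function \<open>k\<close>.\<close>
lemma class_U_koebe_representation:
  assumes f: "f \<in> class_U" and \<rho>: "0 < \<rho>" "\<rho> < 1"
  obtains q where "continuous_on {0..2*pi} q" "\<And>t. 0 \<le> q t" "integral {0..2*pi} q = 1"
    "\<And>z. norm z < \<rho> \<Longrightarrow> f z = integral {0..2*pi}
        (\<lambda>t. of_real (q t) * (of_real \<rho> * cis t) * koebe (1 / (of_real \<rho> * cis t) * z))"
proof -
  obtain F where F: "F holomorphic_on ball 0 1" "F 0 = 1"
    "\<And>z. norm z < 1 \<Longrightarrow> f z = z * (F z)\<^sup>2" "\<And>z. norm z < 1 \<Longrightarrow> 1/2 < Re (F z)"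
    using class_U_sqrt_quotient[OF f] by blast
  obtain H where H: "H holomorphic_on ball 0 1" "H 0 = 1" "\<And>z. norm z < 1 \<Longrightarrow> 1/2 < Re (H z)"
    "\<And>z. norm z < 1 \<Longrightarrow> ((\<lambda>z. z * H z) has_field_derivative (F z)\<^sup>2) (at z)"
    using averaged_quotient_half_plane[OF F(1,2,4)] by blast
  define x where "x t = 1 / (complex_of_real \<rho> * cis t)" for t
  define q where "q t = (2 * Re (H (of_real \<rho> * cis t)) - 1) / (2 * pi)" for t
  define c where "c t = complex_of_real (q t) * (of_real \<rho> * cis t)" for t
  define K where "K \<zeta> = \<zeta> / (1 - \<zeta>)" for \<zeta> :: complex
  have x0: "x t \<noteq> 0" for t using \<rho> by (simp add: x_def)
  have nx: "norm (x t) = 1 / \<rho>" for t using \<rho> by (simp add: x_def norm_divide norm_mult)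
  have cx: "c t = of_real (q t) / x t" for t by (simp add: c_def x_def)
  have qc: "continuous_on {0..2*pi} q"
    unfolding q_def
    by (intro continuous_intros continuous_on_compose2[OF holomorphic_on_imp_continuous_on[OF H(1)]])
       (use \<rho> in \<open>auto simp: norm_mult\<close>)
  have q0: "0 \<le> q t" for t using H(3)[of "of_real \<rho> * cis t"] \<rho> by (simp add: q_def norm_mult)
  have her: "integral {0..2*pi} (\<lambda>t. of_real (q t) / (1 - x t * z)) = H z" if "norm z < \<rho>" for z
  proof -
    from has_integral_mult_right[OF Herglotz_formula_circle[OF H(1,2) \<rho>(2) that], of "1 / complex_of_real (2 * pi)"]
    show ?thesis by (intro integral_unique) (simp add: q_def x_def)
  qed
  have q1: "integral {0..2*pi} q = 1"
  proof -
    have "complex_of_real (integral {0..2*pi} q) = integral {0..2*pi} (\<lambda>t. of_real (q t))"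
      by (intro integral_linear[OF _ bounded_linear_of_real, unfolded o_def, symmetric] integrable_continuous_interval qc)
    also have "\<dots> = 1" using her[of 0] \<rho> H(2) by simp
    finally show ?thesis by (metis of_real_eq_1_iff)
  qed
  have Kh: "K holomorphic_on ball 0 1" unfolding K_def[abs_def] by (auto intro!: holomorphic_intros)
  have dK: "deriv K \<zeta> = 1 / (1 - \<zeta>)\<^sup>2" if "norm \<zeta> < 1" for \<zeta>
  proof -
    have "1 - \<zeta> \<noteq> 0" using that by auto
    then have "(K has_field_derivative 1 / (1 - \<zeta>)\<^sup>2) (at \<zeta>)"
      unfolding K_def[abs_def] by (auto intro!: derivative_eq_intros simp: power2_eq_square field_simps)
    then show ?thesis by (rule DERIV_imp_deriv)
  qed
  have "f z = integral {0..2*pi} (\<lambda>t. c t * koebe (x t * z))" if z: "norm z < \<rho>" for z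
  proof -
    have xz: "norm (x t * z) < 1" for t using z \<rho> by (simp add: norm_mult nx field_simps)
    have zH: "integral {0..2*pi} (\<lambda>t. c t * K (x t * z)) = z * H z" if "norm z < \<rho>" for z
      unfolding her[OF that, symmetric] integral_mult_right[symmetric]
      using x0 by (simp add: cx K_def mult.commute)
    have "((\<lambda>z. integral {0..2*pi} (\<lambda>t. c t * K (x t * z))) has_field_derivative
        integral {0..2*pi} (\<lambda>t. c t * x t * deriv K (x t * z))) (at z)"
    proof (rule deriv_weighted_dilations[OF Kh _ _ _ z])
      show "continuous_on {0..2*pi} c" "continuous_on {0..2*pi} x"
        unfolding c_def[abs_def] x_def[abs_def] using \<rho> by (auto intro!: continuous_intros qc)
    qed (simp add: nx)
    then have "((\<lambda>z. z * H z) has_field_derivative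
        integral {0..2*pi} (\<lambda>t. c t * x t * deriv K (x t * z))) (at z)"
      by (rule has_field_derivative_transform_within_open[of _ _ _ "ball 0 \<rho>"]) (use z zH in auto)
    then have "(F z)\<^sup>2 = integral {0..2*pi} (\<lambda>t. c t * x t * deriv K (x t * z))"
      using H(4)[of z] z \<rho> by (intro DERIV_unique) auto
    then have "f z = integral {0..2*pi} (\<lambda>t. z * (c t * x t * deriv K (x t * z)))"
      using F(3)[of z] z \<rho> by simp
    also have "(\<lambda>t. z * (c t * x t * deriv K (x t * z))) = (\<lambda>t. c t * koebe (x t * z))"
      by (simp add: dK[OF xz] koebe_def fun_eq_iff)
    finally show ?thesis .
  qed
  with that qc q0 q1 show ?thesis unfolding c_def x_def by blast
qed

section \<open>Comparison of integral means\<close>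

lemma circle_mean_cis:
  "circle_mean p r g = 1 / (2 * pi) * integral {0..2*pi} (\<lambda>t. norm (g (of_real r * cis t)) powr p)"
  by (simp add: circle_mean_def cis_conv_exp)

text \<open>Differentiating the representation \<open>n\<close> times multiplies the weight by \<open>x\<^sup>n\<close>, of modulus \<open>\<rho>\<^sup>-\<^sup>n\<close>. Jensen's
inequality moves the power inside the average, and after exchanging the integrals the inner one is the mean
of \<open>|k\<^sup>(\<^sup>n\<^sup>)|\<^sup>p\<close> over the circle of radius \<open>r/\<rho>\<close> for every value of the outer variable.\<close>
lemma class_U_higher_deriv_mean_le_dilated:
  assumes f: "f \<in> class_U" and r: "0 < r" "r < \<rho>" "\<rho> < 1" and p: "1 \<le> p"
  shows "circle_mean p r ((deriv ^^ n) f) \<le>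
    (\<rho> * (1 / \<rho>) ^ n) powr p * circle_mean p (r / \<rho>) ((deriv ^^ n) koebe)"
proof -
  have \<rho>: "0 < \<rho>" using r by simp
  obtain q where q: "continuous_on {0..2*pi} q" "\<And>t. 0 \<le> q t" "integral {0..2*pi} q = 1"
    and rep: "\<And>z. norm z < \<rho> \<Longrightarrow> f z = integral {0..2*pi}
        (\<lambda>t. of_real (q t) * (of_real \<rho> * cis t) * koebe (1 / (of_real \<rho> * cis t) * z))"
    using class_U_koebe_representation[OF f \<rho> r(3)] by blast
  define g where "g = (deriv ^^ n) koebe"
  define R where "R = r / \<rho>"
  define A where "A = \<rho> * (1 / \<rho>) ^ n"
  have R: "0 < R" "R < 1" using r \<rho> by (auto simp: R_def)
  have A: "0 \<le> A" using \<rho> by (simp add: A_def)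
  have gh: "g holomorphic_on ball 0 1"
    unfolding g_def by (intro holomorphic_higher_deriv koebe_holomorphic) auto
  define G where "G z = norm (g z) powr p" for z
  have ngc: "continuous_on (ball 0 1) (\<lambda>z. norm (g z))"
    by (intro continuous_intros holomorphic_on_imp_continuous_on gh)
  have Gc: "continuous_on (ball 0 1) G"
    unfolding G_def using p by (intro continuous_on_powr' ngc continuous_intros) auto
  have inb: "complex_of_real R * cis s \<in> ball 0 1" for s using R by (simp add: norm_mult)
  have arg: "1 / (of_real \<rho> * cis t) * (of_real r * cis \<theta>) = of_real R * cis (\<theta> - t)" for t \<theta>
    by (simp add: R_def cis_divide[symmetric])
  define c where "c t = of_real (q t) * (of_real \<rho> * cis t) * (1 / (of_real \<rho> * cis t)) ^ n" for t
  have nc: "norm (c t) = q t * A" for t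
    using q(2) \<rho> by (simp add: c_def A_def norm_mult norm_power norm_divide)
  have deriv: "(deriv ^^ n) f (of_real r * cis \<theta>) =
      integral {0..2*pi} (\<lambda>t. c t * g (of_real R * cis (\<theta> - t)))" for \<theta>
  proof -
    have "(deriv ^^ n) f (of_real r * cis \<theta>) =
      integral {0..2*pi} (\<lambda>t. of_real (q t) * (of_real \<rho> * cis t) * (1 / (of_real \<rho> * cis t)) ^ n *
         (deriv ^^ n) koebe (1 / (of_real \<rho> * cis t) * (of_real r * cis \<theta>)))"
      by (rule higher_deriv_weighted_dilations[OF koebe_holomorphic _ _ _ rep])
         (use r \<rho> in \<open>auto intro!: continuous_intros q simp: norm_mult norm_divide\<close>)
    then show ?thesis unfolding arg c_def g_def .
  qed
  have pointwise: "norm ((deriv ^^ n) f (of_real r * cis \<theta>)) powr p \<le>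
      A powr p * integral {0..2*pi} (\<lambda>t. q t * G (of_real R * cis (\<theta> - t)))" for \<theta>
  proof -
    have cg: "continuous_on {0..2*pi} (\<lambda>t. g (of_real R * cis (\<theta> - t)))"
      by (intro continuous_on_compose2[OF holomorphic_on_imp_continuous_on[OF gh]] continuous_intros) (use inb in auto)
    have "norm ((deriv ^^ n) f (of_real r * cis \<theta>)) \<le>
        integral {0..2*pi} (\<lambda>t. A * (q t * norm (g (of_real R * cis (\<theta> - t)))))"
      unfolding deriv
    proof (rule integral_norm_bound_integral)
      show "(\<lambda>t. c t * g (of_real R * cis (\<theta> - t))) integrable_on {0..2*pi}"
        unfolding c_def using \<rho> by (intro integrable_continuous_interval continuous_intros q cg) auto
      show "(\<lambda>t. A * (q t * norm (g (of_real R * cis (\<theta> - t))))) integrable_on {0..2*pi}"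
        by (intro integrable_continuous_interval continuous_intros q cg)
    qed (simp add: norm_mult nc)
    also have "\<dots> = A * integral {0..2*pi} (\<lambda>t. q t * norm (g (of_real R * cis (\<theta> - t))))" by simp
    finally have "norm ((deriv ^^ n) f (of_real r * cis \<theta>)) powr p \<le>
       (A * integral {0..2*pi} (\<lambda>t. q t * norm (g (of_real R * cis (\<theta> - t))))) powr p"
      using p by (intro powr_mono2) auto
    also have "\<dots> = A powr p * integral {0..2*pi} (\<lambda>t. q t * norm (g (of_real R * cis (\<theta> - t)))) powr p"
      using A q(2) by (intro powr_mult)
    also have "\<dots> \<le> A powr p * integral {0..2*pi} (\<lambda>t. q t * G (of_real R * cis (\<theta> - t)))"
      unfolding G_def
      by (intro mult_left_mono powr_Jensen_integral p q(1,3) continuous_intros cg) (auto simp: q(2))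
    finally show ?thesis .
  qed
  have Gcomp: "continuous_on S (\<lambda>s. G (of_real R * cis (u s)))" if "continuous_on S u" for S :: "'b::topological_space set" and u
    by (intro continuous_on_compose2[OF Gc] continuous_intros that) (use inb in auto)
  have joint: "continuous_on (cbox (0,0) (2*pi,2*pi)) (\<lambda>(\<theta>,t). q t * G (of_real R * cis (\<theta> - t)))"
  proof -
    have "continuous_on (cbox (0,0) (2*pi,2*pi::real)) (\<lambda>z. q (snd z))"
      by (rule continuous_on_compose2[OF q(1)]) (auto intro: continuous_intros simp: cbox_Pair_eq)
    then show ?thesis unfolding case_prod_beta by (intro continuous_intros Gcomp)
  qed
  have "integral {0..2*pi} (\<lambda>\<theta>. norm ((deriv ^^ n) f (of_real r * cis \<theta>)) powr p) \<le>
     integral {0..2*pi} (\<lambda>\<theta>. A powr p * integral {0..2*pi} (\<lambda>t. q t * G (of_real R * cis (\<theta> - t))))"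
  proof (rule integral_le)
    have fh: "f holomorphic_on ball 0 1" using f by (simp add: class_U_def class_A_def)
    have cf: "continuous_on {0..2*pi} (\<lambda>\<theta>. (deriv ^^ n) f (of_real r * cis \<theta>))"
      by (intro continuous_on_compose2[OF holomorphic_on_imp_continuous_on[OF holomorphic_higher_deriv[OF fh open_ball]]]
           continuous_intros) (use r in \<open>auto simp: norm_mult\<close>)
    show "(\<lambda>\<theta>. norm ((deriv ^^ n) f (of_real r * cis \<theta>)) powr p) integrable_on {0..2*pi}"
      using p by (intro integrable_continuous_interval continuous_on_powr' continuous_intros cf) auto
    have "continuous_on {0..2*pi} (\<lambda>\<theta>. integral (cbox 0 (2*pi)) (\<lambda>t. q t * G (of_real R * cis (\<theta> - t))))"
      by (rule integral_continuous_on_param) (use joint in \<open>simp add: cbox_Pair_eq\<close>)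
    then show "(\<lambda>\<theta>. A powr p * integral {0..2*pi} (\<lambda>t. q t * G (of_real R * cis (\<theta> - t)))) integrable_on {0..2*pi}"
      by (intro integrable_continuous_interval continuous_intros) simp
  qed (rule pointwise)
  also have "\<dots> = A powr p * integral {0..2*pi} (\<lambda>\<theta>. integral {0..2*pi} (\<lambda>t. q t * G (of_real R * cis (\<theta> - t))))" by simp
  also have "integral {0..2*pi} (\<lambda>\<theta>. integral {0..2*pi} (\<lambda>t. q t * G (of_real R * cis (\<theta> - t)))) =
     integral {0..2*pi} (\<lambda>t. integral {0..2*pi} (\<lambda>\<theta>. q t * G (of_real R * cis (\<theta> - t))))"
    using integral_swap_continuous[OF joint] by simp
  also have "\<dots> = integral {0..2*pi} (\<lambda>t. q t * integral {0..2*pi} (\<lambda>\<theta>. G (of_real R * cis \<theta>)))"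
  proof (rule integral_cong)
    fix t assume t: "t \<in> {0..2*pi}"
    have "continuous_on (sphere 0 R) G" by (rule continuous_on_subset[OF Gc]) (use R in auto)
    from integral_circle_rotate[OF this _ t] R
    show "integral {0..2*pi} (\<lambda>\<theta>. q t * G (of_real R * cis (\<theta> - t))) = q t * integral {0..2*pi} (\<lambda>\<theta>. G (of_real R * cis \<theta>))"
      by simp
  qed
  also have "\<dots> = integral {0..2*pi} (\<lambda>\<theta>. G (of_real R * cis \<theta>))"
    by (simp add: q(3))
  finally show ?thesis
    unfolding circle_mean_cis A_def R_def G_def g_def by (simp add: field_simps)
qed

text \<open>Let \<open>\<rho>\<close> tend to 1 in the dilated inequality.\<close>
lemma class_U_higher_deriv_mean:
  assumes f: "f \<in> class_U" and r: "0 < r" "r < 1" and p: "1 \<le> p"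
  shows "circle_mean p r ((deriv ^^ n) f) \<le> circle_mean p r ((deriv ^^ n) koebe)"
proof -
  define g where "g = (deriv ^^ n) koebe"
  have gh: "g holomorphic_on ball 0 1"
    unfolding g_def by (intro holomorphic_higher_deriv koebe_holomorphic) auto
  define \<Phi> where "\<Phi> s = circle_mean p s g" for s
  have "continuous_on {0<..<1} (\<lambda>s. integral (cbox 0 (2*pi)) (\<lambda>t. norm (g (of_real s * cis t)) powr p))"
  proof (rule integral_continuous_on_param)
    have "continuous_on ({0<..<1} \<times> cbox 0 (2*pi)) (\<lambda>z. g (of_real (fst z) * cis (snd z)))"
      by (intro continuous_on_compose2[OF holomorphic_on_imp_continuous_on[OF gh]] continuous_intros)
         (auto simp: norm_mult)
    then show "continuous_on ({0<..<1} \<times> cbox 0 (2*pi)) (\<lambda>(s, t). norm (g (of_real s * cis t)) powr p)"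
      unfolding case_prod_beta using p by (intro continuous_on_powr' continuous_intros) auto
  qed
  then have "continuous_on {0<..<1} \<Phi>" unfolding \<Phi>_def circle_mean_cis by (intro continuous_intros) simp
  then have \<Phi>c: "isCont \<Phi> (r / 1)" using r by (simp add: continuous_on_eq_continuous_at)
  have "((\<lambda>\<rho>. (\<rho> * (1 / \<rho>) ^ n) powr p * \<Phi> (r / \<rho>)) \<longlongrightarrow> (1 * (1 / 1) ^ n) powr p * \<Phi> (r / 1)) (at_left 1)"
    by (intro tendsto_intros isCont_tendsto_compose[OF \<Phi>c]) auto
  moreover have "\<forall>\<^sub>F \<rho> in at_left 1. circle_mean p r ((deriv ^^ n) f) \<le> (\<rho> * (1 / \<rho>) ^ n) powr p * \<Phi> (r / \<rho>)"
    using eventually_at_left_real[OF r(2)]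
    by eventually_elim (use class_U_higher_deriv_mean_le_dilated[OF f r(1) _ _ p] in \<open>simp add: \<Phi>_def g_def\<close>)
  ultimately have "circle_mean p r ((deriv ^^ n) f) \<le> (1 * (1 / 1) ^ n) powr p * \<Phi> (r / 1)"
    by (rule tendsto_lowerbound) simp
  then show ?thesis by (simp add: \<Phi>_def g_def)
qed

text \<open>With \<open>w = 1 - 1/F\<close> one has \<open>f(z) = z/(1 - w(z))\<^sup>2\<close>, and \<open>|1 - \<zeta>|\<^sup>-\<^sup>2\<^sup>p\<close> is the squared modulus of the
holomorphic function \<open>h(\<zeta>) = (1 - \<zeta>)\<^sup>-\<^sup>p\<close> for every real \<open>p\<close>. So subordination in mean square
suffices for all exponents, including the negative ones.\<close>
lemma class_U_mean:
  assumes f: "f \<in> class_U" and r: "0 < r" "r < 1"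
  shows "circle_mean p r f \<le> circle_mean p r koebe"
proof -
  obtain F where F: "F holomorphic_on ball 0 1" "F 0 = 1"
    "\<And>z. norm z < 1 \<Longrightarrow> f z = z * (F z)\<^sup>2" "\<And>z. norm z < 1 \<Longrightarrow> 1/2 < Re (F z)"
    using class_U_sqrt_quotient[OF f] by blast
  define w where "w z = 1 - 1 / F z" for z
  have F0: "F z \<noteq> 0" if "norm z < 1" for z using F(4)[OF that] by auto
  have wh: "w holomorphic_on ball 0 1" unfolding w_def using F0 by (intro holomorphic_intros F(1)) auto
  have w0: "w 0 = 0" by (simp add: w_def F(2))
  have w1: "norm (w z) < 1" if "norm z < 1" for z
  proof -
    have "(norm (F z - 1))\<^sup>2 < (norm (F z))\<^sup>2"
      using F(4)[OF that] unfolding cmod_power2 by (simp add: power2_eq_square algebra_simps)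
    then have "norm (F z - 1) < norm (F z)" by (rule power2_less_imp_less) simp
    moreover have "w z = (F z - 1) / F z" using F0[OF that] by (simp add: w_def diff_divide_distrib)
    ultimately show ?thesis using F0[OF that] by (simp add: norm_divide)
  qed
  have wle: "norm (w z) \<le> norm z" if "norm z < 1" for z
    by (rule Schwarz_Lemma(1)[OF wh w0 w1 that])
  define h where "h \<zeta> = exp (- of_real p * Ln (1 - \<zeta>))" for \<zeta>
  have re: "0 < Re (1 - \<zeta>)" if "norm \<zeta> < 1" for \<zeta> using complex_Re_le_cmod[of \<zeta>] that by simp
  have hh: "h holomorphic_on ball 0 1"
    unfolding h_def by (intro holomorphic_intros) (use re in \<open>force simp: complex_nonpos_Reals_iff\<close>)
  have nh: "(norm (h \<zeta>))\<^sup>2 = (1 / norm (1 - \<zeta>) ^ 2) powr p" if "norm \<zeta> < 1" for \<zeta>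
  proof -
    have ne: "1 - \<zeta> \<noteq> 0" using that by auto
    have "norm (h \<zeta>) = exp (- p * ln (norm (1 - \<zeta>)))" using ne by (simp add: h_def)
    then have "(norm (h \<zeta>))\<^sup>2 = exp (p * (- 2 * ln (norm (1 - \<zeta>))))"
      by (simp add: power2_eq_square exp_add[symmetric])
    also have "- 2 * ln (norm (1 - \<zeta>)) = ln (1 / norm (1 - \<zeta>) ^ 2)"
      using ne by (simp add: ln_div ln_realpow)
    finally show ?thesis using ne by (simp add: powr_def)
  qed
  have mean: "circle_mean p r k = 1 / (2 * pi) * (r powr p * integral {0..2*pi} (\<lambda>t. (norm (h (v (of_real r * cis t))))\<^sup>2))"
    if k: "\<And>z. norm z < 1 \<Longrightarrow> k z = z / (1 - v z)\<^sup>2" and v: "\<And>z. norm z < 1 \<Longrightarrow> norm (v z) < 1" for k v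
  proof -
    have "norm (k (of_real r * cis t)) powr p = r powr p * (norm (h (v (of_real r * cis t))))\<^sup>2" for t
    proof -
      have n: "norm (of_real r * cis t) < 1" using r by (simp add: norm_mult)
      have "norm (k (of_real r * cis t)) = r * (1 / norm (1 - v (of_real r * cis t)) ^ 2)"
        using r unfolding k[OF n] by (simp add: norm_divide norm_mult norm_power)
      then show ?thesis unfolding nh[OF v[OF n]] using r by (simp only: powr_mult less_imp_le)
    qed
    then show ?thesis by (simp add: circle_mean_cis)
  qed
  have "circle_mean p r f = 1 / (2 * pi) * (r powr p * integral {0..2*pi} (\<lambda>t. (norm (h (w (of_real r * cis t))))\<^sup>2))"
    by (rule mean) (use F(3) w1 in \<open>auto simp: w_def power_divide\<close>)
  also have "\<dots> \<le> 1 / (2 * pi) * (r powr p * integral {0..2*pi} (\<lambda>t. (norm (h (of_real r * cis t)))\<^sup>2))"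
    by (intro mult_left_mono L2_subordination[OF hh wh w0 wle r]) auto
  also have "\<dots> = circle_mean p r koebe"
    using mean[of koebe "\<lambda>z. z"] by (simp add: koebe_def)
  finally show ?thesis .
qed

theorem theorem2p2:
  fixes f :: "complex \<Rightarrow> complex"
  assumes "f \<in> class_U"
  shows "(\<forall>(r::real) (p::real) (n::nat). 0 < r \<longrightarrow> r < 1 \<longrightarrow> 1 \<le> p \<longrightarrow>
            circle_mean p r ((deriv ^^ n) f) \<le> circle_mean p r ((deriv ^^ n) koebe)) \<and>
         (\<forall>(r::real) (p::real). 0 < r \<longrightarrow> r < 1 \<longrightarrow>
            circle_mean p r f \<le> circle_mean p r koebe)"
  using class_U_higher_deriv_mean[OF assms] class_U_mean[OF assms] by blast

end
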